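(* Let $h(x)$ be a polynomial with real coefficients and let $L_{h,n}(x)$ be defined by $L_{h,0}=2$, $L_{h,1}=h(x)$, $L_{h,n+1}=h(x)L_{h,n}+L_{h,n-1}$ ($n\ge1$). Fix an integer $l\ge1$ and set $L_{h,n}^l(x)=\sum_{i=0}^{l}\frac{n}{n-i}\binom{n-i}{i}h^{n-2i}(x)$ for $n\ge 2l$ and $L_{h,n}^l(x)=0$ for $0\le n<2l$. Then, as formal power series in $t$, $$\sum_{i=0}^{\infty}L_{h,i}^{l}(x)\,t^{i}=\frac{t^{2l}\left[L_{h,2l}(x)+\big(L_{h,2l+1}(x)-h(x)L_{h,2l}(x)\big)t-\dfrac{t^{2}\,(2-h(x)t)}{(1-h(x)t)^{l+1}}\right]}{1-h(x)t-t^{2}}.$$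
   Context: $h(x)$ is a polynomial with real coefficients. $L_{h,n}$ are the $h(x)$-Lucas polynomials and $L^l_{h,n}$ the incomplete $h(x)$-Lucas polynomials (extended by $0$ for $n<2l$). *)

theory Defs
  imports "HOL-Computational_Algebra.Computational_Algebra"
begin

fun lucas_poly :: "real poly \<Rightarrow> nat \<Rightarrow> real poly" where
  "lucas_poly h 0 = 2"
| "lucas_poly h (Suc 0) = h"
| "lucas_poly h (Suc (Suc n)) = h * lucas_poly h (Suc n) + lucas_poly h n"

text \<open>
  In the nontrivial branch the natural number subtractions do not truncate, and the
  denominator \<open>n - i\<close> is nonzero as soon as \<open>n > 0\<close>, since \<open>i \<le> l\<close> and \<open>2 * l \<le> n\<close>.
\<close>

definition incomplete_lucas_poly :: "real poly \<Rightarrow> nat \<Rightarrow> nat \<Rightarrow> real poly" where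
  "incomplete_lucas_poly h l n =
     (if 2 * l \<le> n
      then \<Sum>i=0..l. smult (real n / real (n - i) * real ((n - i) choose i)) (h ^ (n - 2 * i))
      else 0)"

text \<open>
  Division of formal power series in the library needs inverses of coefficients, so series
  over \<open>\<real>[x]\<close> are read in \<open>\<real>(x)[[t]]\<close>, with \<open>fps_X\<close> in the role of \<open>t\<close>. The embedding
  \<open>\<real>[x][[t]] \<rightarrow> \<real>(x)[[t]]\<close> is injective, and for denominators with constant term \<open>1\<close> the
  quotients in the two rings agree.
\<close>

abbreviation const_series :: "real poly \<Rightarrow> real poly fract fps" where
  "const_series p \<equiv> fps_const (to_fract p)"

definition gen_series :: "(nat \<Rightarrow> real poly) \<Rightarrow> real poly fract fps" where
  "gen_series a = Abs_fps (\<lambda>i. to_fract (a i))"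

end

theory Submission
  imports Defs
begin

text \<open>
  Write \<open>c(n, i) = n / (n - i) * (n - i choose i)\<close>, \<open>W(n)\<close> for the \<open>l\<close>-th incomplete polynomial
  and \<open>n \<ge> 2 * l\<close>. The Pascal-type recurrence of the \<open>c(n, i)\<close> gives
  \<open>W(n + 2) = h * W(n + 1) + W(n) - c(n, l) * h ^ (n - 2 * l)\<close>, the last term being the one that
  truncation cuts off. Multiplying the series by \<open>1 - h * t - t ^ 2\<close> therefore leaves the two
  initial values and the series of these defects. Since
  \<open>c(m + 2 * l, l) = 2 * (m + l choose l) - (m + l - 1 choose l)\<close>, the latter is \<open>2 - h * t\<close>
  times the negative binomial series \<open>1 / (1 - h * t) ^ (l + 1)\<close>.
\<close>

definition lucas_coeff :: "nat \<Rightarrow> nat \<Rightarrow> real" where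
  "lucas_coeff n i = real n / real (n - i) * real ((n - i) choose i)"

definition lucas_partial_sum :: "real poly \<Rightarrow> nat \<Rightarrow> nat \<Rightarrow> real poly" where
  "lucas_partial_sum h l n = (\<Sum>i\<le>l. smult (lucas_coeff n i) (h ^ (n - 2 * i)))"

lemma incomplete_lucas_poly_eq:
  "incomplete_lucas_poly h l n = (if 2 * l \<le> n then lucas_partial_sum h l n else 0)"
  by (simp add: incomplete_lucas_poly_def lucas_partial_sum_def lucas_coeff_def atLeast0AtMost)

lemma lucas_coeff_0: "n > 0 \<Longrightarrow> lucas_coeff n 0 = 1"
  by (simp add: lucas_coeff_def)

lemma lucas_coeff_eq_0: "n < 2 * i \<Longrightarrow> lucas_coeff n i = 0"
  by (auto simp: lucas_coeff_def)

text \<open>With \<open>j = Suc i\<close>, split \<open>n / (n - j) = 1 + j / (n - j)\<close> and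
  absorb the second factor into the binomial. This form has no division, so Pascal's rule applies to
  it.\<close>

lemma lucas_coeff_Suc_eq_binomial_sum:
  assumes "Suc i < n"
  shows "lucas_coeff n (Suc i) = real ((n - Suc i) choose Suc i) + real ((n - i - 2) choose i)"
proof -
  define k where "k = n - i - 2"
  have n: "n = k + i + 2" using assms by (simp add: k_def)
  have "real (Suc k) * real (k choose i) = real (Suc k choose Suc i) * real (Suc i)"
    using Suc_times_binomial_eq[of k i] by (metis of_nat_mult)
  then show ?thesis
    by (simp add: lucas_coeff_def n field_simps del: binomial_Suc_Suc)
qed

text \<open>Pascal's rule on both binomials of the split form. The recurrence fails at
  \<open>n = 0\<close>, where division by zero makes \<open>lucas_coeff 0 0\<close> equal to 0
  instead of 2.\<close>

lemma lucas_coeff_rec: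
  assumes "n > 0" "2 * i \<le> n"
  shows "lucas_coeff (n + 2) (Suc i) = lucas_coeff (n + 1) (Suc i) + lucas_coeff n i"
proof (cases i)
  case 0
  then show ?thesis
    using assms by (simp add: lucas_coeff_def field_simps)
next
  case (Suc j)
  define k where "k = n - j - 2"
  have n: "n = k + j + 2" using assms Suc by (simp add: k_def)
  have "k > 0 \<or> j = 0" using assms Suc n by auto
  then show ?thesis
    using assms by (auto simp: Suc n lucas_coeff_Suc_eq_binomial_sum gr0_conv_Suc)
qed

text \<open>For \<open>n = 2l\<close> the exponent \<open>n + 1 - 2i\<close> truncates at \<open>i = l + 1\<close>, but there the
  coefficient vanishes.\<close>

lemma lucas_partial_sum_rec:
  assumes "n > 0" "2 * l \<le> n"
  shows "lucas_partial_sum h (Suc l) (n + 2) =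
    h * lucas_partial_sum h (Suc l) (n + 1) + lucas_partial_sum h l n"
proof -
  have *: "smult (lucas_coeff (n + 2) (Suc i)) (h ^ (n + 2 - 2 * Suc i)) =
      h * smult (lucas_coeff (n + 1) (Suc i)) (h ^ (n + 1 - 2 * Suc i))
      + smult (lucas_coeff n i) (h ^ (n - 2 * i))" if "i \<le> l" for i
  proof -
    have "h * smult (lucas_coeff (n + 1) (Suc i)) (h ^ (n + 1 - 2 * Suc i)) =
        smult (lucas_coeff (n + 1) (Suc i)) (h ^ (n - 2 * i))"
    proof (cases "n = 2 * i")
      case True
      then show ?thesis by (simp add: lucas_coeff_eq_0)
    next
      case False
      then have "n - 2 * i = Suc (n + 1 - 2 * Suc i)" using assms that by simp
      then show ?thesis by (simp only: mult_smult_right power_Suc)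
    qed
    then show ?thesis
      using lucas_coeff_rec[of n i] assms that by (simp add: smult_add_left)
  qed
  \<comment> \<open>The terms with index 0 have coefficient 1 and match by this identity; the
    shifted indices \<open>Suc i\<close> are covered by \<open>*\<close>.\<close>
  have "h ^ (n + 2) = h * (h * h ^ n)"
    by simp
  then show ?thesis
    unfolding lucas_partial_sum_def sum.atMost_Suc_shift
    by (simp add: * lucas_coeff_0 sum.distrib sum_distrib_left distrib_left
        del: mult_Suc_right add_2_eq_Suc' mult_smult_right)
qed

text \<open>For \<open>n = 2 * l\<close> and \<open>n = 2 * l + 1\<close> truncation at
  \<open>l\<close> loses nothing. Both values go through the induction together, since the
  recurrence has order two.\<close>

lemma lucas_poly_eq_lucas_partial_sum:
  assumes "l \<ge> 1"
  shows "lucas_poly h (2 * l) = lucas_partial_sum h l (2 * l) \<and>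
    lucas_poly h (2 * l + 1) = lucas_partial_sum h l (2 * l + 1)"
  using assms
proof (induction l rule: dec_induct)
  case base
  have "smult 2 1 = (2 :: real poly)" "smult 3 h = 2 * h + h"
    by (simp_all add: smult_add_left[of 2 1, simplified] numeral_poly)
  then show ?case
    by (simp add: lucas_partial_sum_def lucas_coeff_def numeral_eq_Suc algebra_simps)
next
  case (step l)
  \<comment> \<open>The recurrence calls for truncation at \<open>Suc l\<close> here; the extra term
    vanishes.\<close>
  have "lucas_partial_sum h (Suc l) (2 * l + 1) = lucas_partial_sum h l (2 * l + 1)"
    by (simp add: lucas_partial_sum_def lucas_coeff_eq_0)
  then show ?case
    using step lucas_partial_sum_rec[of "2 * l" l h] lucas_partial_sum_rec[of "2 * l + 1" l h]
    by simp
qed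

lemma lucas_partial_sum_defect_rec:
  assumes "l \<ge> 1" "2 * l \<le> n"
  shows "lucas_partial_sum h l (n + 2) =
    h * lucas_partial_sum h l (n + 1) + lucas_partial_sum h l n
      - smult (lucas_coeff n l) (h ^ (n - 2 * l))"
proof -
  obtain k where l: "l = Suc k" using assms(1) by (cases l) auto
  have "lucas_partial_sum h l n = lucas_partial_sum h k n + smult (lucas_coeff n l) (h ^ (n - 2 * l))"
    by (simp add: lucas_partial_sum_def l)
  then show ?thesis
    using lucas_partial_sum_rec[of n k h] assms l by simp
qed

definition neg_binomial_series :: "'a :: comm_ring_1 \<Rightarrow> nat \<Rightarrow> 'a fps" where
  "neg_binomial_series c l = Abs_fps (\<lambda>m. of_nat ((m + l) choose l) * c ^ m)"

lemma fps_mult_one_minus_const_X_nth: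
  fixes F :: "'a :: comm_ring_1 fps"
  shows "(F * (1 - fps_const c * fps_X)) $ m = F $ m - (if m = 0 then 0 else c * F $ (m - 1))"
proof -
  have "F * (1 - fps_const c * fps_X) = F - fps_const c * (F * fps_X)"
    by (simp add: right_diff_distrib mult.left_commute)
  then show ?thesis
    by simp
qed

text \<open>By Pascal's rule, each factor \<open>1 - c * t\<close> lowers \<open>l\<close> by
  one.\<close>

lemma neg_binomial_series_mult_power:
  "neg_binomial_series c l * (1 - fps_const c * fps_X) ^ Suc l = 1"
proof (induction l)
  case 0
  show ?case
  proof (rule fps_ext)
    fix m
    show "(neg_binomial_series c 0 * (1 - fps_const c * fps_X) ^ Suc 0) $ m = 1 $ m"
      by (cases m) (simp_all add: fps_mult_one_minus_const_X_nth neg_binomial_series_def)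
  qed
next
  case (Suc l)
  have "neg_binomial_series c (Suc l) * (1 - fps_const c * fps_X) = neg_binomial_series c l"
  proof (rule fps_ext)
    fix m
    show "(neg_binomial_series c (Suc l) * (1 - fps_const c * fps_X)) $ m
        = neg_binomial_series c l $ m"
      by (cases m)
        (simp_all add: fps_mult_one_minus_const_X_nth neg_binomial_series_def algebra_simps
          binomial_eq_0)
  qed
  then show ?case
    using Suc by (simp add: mult.assoc[symmetric])
qed

text \<open>Pascal's rule turns the second binomial of the split form into a difference. The case
  \<open>m = 0\<close> is separate because \<open>m - 1\<close> would truncate and contribute
  1.\<close>

lemma lucas_coeff_eq_binomial_diff:
  assumes "l \<ge> 1"
  shows "lucas_coeff (m + 2 * l) l =
    2 * real ((m + l) choose l) - (if m = 0 then 0 else real ((m - 1 + l) choose l))"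
proof (cases m)
  case 0
  then show ?thesis using assms by (simp add: lucas_coeff_def)
next
  case (Suc k)
  obtain j where l: "l = Suc j" using assms by (cases l) auto
  show ?thesis
    using Suc l by (simp add: lucas_coeff_Suc_eq_binomial_sum add.commute)
qed

lemma to_fract_of_nat [simp]: "to_fract (of_nat n) = of_nat n"
  by (induction n) simp_all

lemma to_fract_power [simp]: "to_fract (x ^ n) = to_fract x ^ n"
  by (induction n) simp_all

lemma gen_series_lucas_coeff:
  assumes "l \<ge> 1"
  shows "gen_series (\<lambda>m. smult (lucas_coeff (m + 2 * l) l) (h ^ m)) =
    (2 - const_series h * fps_X) * neg_binomial_series (to_fract h) l"
proof (rule fps_ext)
  fix m
  have smult_of_nat: "smult (real k) p = of_nat k * p" for k p
    by (simp add: of_nat_poly)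
  define b where "b m = (m + l) choose l" for m
  \<comment> \<open>Real scalars become \<open>of_nat\<close> factors, through which
    \<open>to_fract\<close> passes.\<close>
  have "smult (lucas_coeff (m + 2 * l) l) (h ^ m) =
    of_nat 2 * (of_nat (b m) * h ^ m)
      - (if m = 0 then 0 else h * (of_nat (b (m - 1)) * h ^ (m - 1)))"
    unfolding lucas_coeff_eq_binomial_diff[OF assms] b_def[symmetric] smult_of_nat[symmetric]
    by (cases m) (simp_all add: smult_diff_left)
  then show "gen_series (\<lambda>m. smult (lucas_coeff (m + 2 * l) l) (h ^ m)) $ m =
    ((2 - const_series h * fps_X) * neg_binomial_series (to_fract h) l) $ m"
    by (simp add: gen_series_def neg_binomial_series_def b_def left_diff_distrib mult.assoc
        numeral_fps_const del: of_nat_numeral)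
qed

theorem theorem18:
  fixes h :: "real poly" and l :: nat
  assumes "l \<ge> 1"
  shows "gen_series (incomplete_lucas_poly h l) =
    fps_X ^ (2 * l) *
      (const_series (lucas_poly h (2 * l))
       + const_series (lucas_poly h (2 * l + 1) - h * lucas_poly h (2 * l)) * fps_X
       - fps_X ^ 2 * (2 - const_series h * fps_X) / (1 - const_series h * fps_X) ^ (l + 1))
    / (1 - const_series h * fps_X - fps_X ^ 2)"
proof -
  let ?H = "const_series h"
  let ?D = "1 - ?H * fps_X - fps_X ^ 2"
  let ?W = "\<lambda>n. lucas_partial_sum h l n"
  let ?B = "gen_series (\<lambda>n. ?W (n + 2 * l))"
  let ?T = "gen_series (\<lambda>m. smult (lucas_coeff (m + 2 * l) l) (h ^ m))"
  let ?I = "const_series (?W (2 * l)) + const_series (?W (2 * l + 1) - h * ?W (2 * l)) * fps_X"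
  have nz: "(1 - ?H * fps_X) ^ (l + 1) \<noteq> 0"
    using neg_binomial_series_mult_power[of "to_fract h" l] by auto
  have quot: "fps_X ^ 2 * (2 - ?H * fps_X) / (1 - ?H * fps_X) ^ (l + 1) = fps_X ^ 2 * ?T"
  proof -
    have "fps_X ^ 2 * (2 - ?H * fps_X) = (fps_X ^ 2 * ?T) * (1 - ?H * fps_X) ^ (l + 1)"
      using neg_binomial_series_mult_power[of "to_fract h" l]
      by (simp add: gen_series_lucas_coeff[OF assms] mult.assoc)
    then show ?thesis
      using nonzero_mult_div_cancel_right[OF nz] by (simp only:)
  qed
  have shift: "gen_series (incomplete_lucas_poly h l) = fps_X ^ (2 * l) * ?B"
    by (rule fps_ext) (simp add: gen_series_def incomplete_lucas_poly_eq fps_X_power_mult_nth)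
  \<comment> \<open>Degrees 0 and 1 give the initial values; degree \<open>k + 2\<close> gives the
    defect at \<open>k + 2 * l\<close>.\<close>
  have "?B * ?D = ?I - fps_X ^ 2 * ?T"
  proof (rule fps_ext)
    fix n
    have D: "(?B * ?D) $ n =
        (?B * (1 - ?H * fps_X)) $ n - (if n < 2 then 0 else ?B $ (n - 2))"
      by (simp add: right_diff_distrib fps_X_power_mult_right_nth)
    consider "n = 0" | "n = 1" | k where "n = k + 2"
      by (metis One_nat_def add_2_eq_Suc' not0_implies_Suc)
    then show "(?B * ?D) $ n = (?I - fps_X ^ 2 * ?T) $ n"
    proof cases
      case (3 k)
      then show ?thesis
        using lucas_partial_sum_defect_rec[OF assms, of "k + 2 * l" h]
        unfolding D
        by (simp add: fps_mult_one_minus_const_X_nth gen_series_def fps_X_power_mult_nth)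
    qed (unfold D, simp_all add: fps_mult_one_minus_const_X_nth gen_series_def fps_X_power_mult_nth)
  qed
  moreover have "?D \<noteq> 0"
  proof -
    have "?D $ 0 = 1" by simp
    then show ?thesis by (metis fps_zero_nth zero_neq_one)
  qed
  ultimately have "fps_X ^ (2 * l) * ?B = fps_X ^ (2 * l) * (?I - fps_X ^ 2 * ?T) / ?D"
    using nonzero_mult_div_cancel_right[of ?D "fps_X ^ (2 * l) * ?B"]
    by (simp only: mult.assoc not_False_eq_True)
  moreover have "lucas_poly h (2 * l) = ?W (2 * l)" "lucas_poly h (2 * l + 1) = ?W (2 * l + 1)"
    using lucas_poly_eq_lucas_partial_sum[OF assms] by auto
  ultimately show ?thesis
    by (simp only: quot shift)
qed

end
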